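(* Let $X$ be a complete uniform space whose uniformity is generated by a saturated family of pseudometrics $\{d_\lambda\}_{\lambda\in\Lambda}$. Let $T:X\to\mathcal{C}(X)$ be a multivalued function and suppose that for each $\lambda\in\Lambda$, $\varphi_\lambda:X\to\mathbb{R}$ is a lower semi-continuous and bounded below function. Then the following two propositions hold: (1) If for each $x\in X$ there exists $y\in Tx$ such that for each $\lambda\in\Lambda$, $d_\lambda(x,y)\le\varphi_\lambda(x)-\varphi_\lambda(y)$, then $T$ has a fixed point, i.e. there is $x^*\in X$ with $x^*\in Tx^*$. (2) If for each $x\in X$, each $y\in Tx$ and each $\lambda\in\Lambda$, $d_\lambda(x,y)\le\varphi_\lambda(x)-\varphi_\lambda(y)$, then there exists $x^*\in X$ such that $\{x^*\}=Tx^*$.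
   Context: $X$ carries the topology induced by its uniformity, and $\mathcal{C}(X)$ is the family of all closed and nonempty subsets of $X$. Complete means that every Cauchy filter base in $X$ converges, where a filter base is Cauchy if for each $\lambda\in\Lambda$ and $\epsilon>0$ it contains a set $A$ with $d_\lambda(x,y)<\epsilon$ for all $x,y\in A$. The family $\{d_\lambda\}_{\lambda\in\Lambda}$ is saturated if for all $\lambda,\mu\in\Lambda$ there is $\nu\in\Lambda$ with $\max\{d_\lambda(x,y),d_\mu(x,y)\}\le d_\nu(x,y)$ for all $x,y\in X$.
   Formalization: Proposition (2) is proved under the added assumption that X is Hausdorff; without it (2) is false: on a two-point X with the zero pseudometric, Tx = X and φ = 0 meet all hypotheses, yet no Tx is a singleton. *)

theory Defs
  imports "HOL-Analysis.Analysis"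
begin

definition pseudometric :: "('a \<Rightarrow> 'a \<Rightarrow> real) \<Rightarrow> bool" where
  "pseudometric d \<longleftrightarrow>
     (\<forall>x y. 0 \<le> d x y) \<and> (\<forall>x. d x x = 0) \<and> (\<forall>x y. d x y = d y x) \<and>
     (\<forall>x y z. d x z \<le> d x y + d y z)"

definition saturated_family :: "'i set \<Rightarrow> ('i \<Rightarrow> 'a \<Rightarrow> 'a \<Rightarrow> real) \<Rightarrow> bool" where
  "saturated_family \<Lambda> d \<longleftrightarrow>
     (\<forall>l\<in>\<Lambda>. \<forall>m\<in>\<Lambda>. \<exists>n\<in>\<Lambda>. \<forall>x y. max (d l x y) (d m x y) \<le> d n x y)"

(* The infimum of principal filters is the filter of entourages having the sets
   {(x, y). d l x y < e} as a subbase. *)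
definition uniformity_generated_by ::
    "'i set \<Rightarrow> ('i \<Rightarrow> 'a::uniform_space \<Rightarrow> 'a \<Rightarrow> real) \<Rightarrow> bool" where
  "uniformity_generated_by \<Lambda> d \<longleftrightarrow>
     uniformity = (INF l\<in>\<Lambda>. INF e\<in>{0<..}. principal {(x, y). d l x y < e})"

definition lower_semicontinuous :: "('a::topological_space \<Rightarrow> real) \<Rightarrow> bool" where
  "lower_semicontinuous f \<longleftrightarrow> (\<forall>x a. a < f x \<longrightarrow> (\<forall>\<^sub>F y in nhds x. a < f y))"

definition filter_base :: "'a set set \<Rightarrow> bool" where
  "filter_base B \<longleftrightarrow> B \<noteq> {} \<and> {} \<notin> B \<and> (\<forall>A\<in>B. \<forall>A'\<in>B. \<exists>C\<in>B. C \<subseteq> A \<inter> A')"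

definition cauchy_filter_base ::
    "'i set \<Rightarrow> ('i \<Rightarrow> 'a \<Rightarrow> 'a \<Rightarrow> real) \<Rightarrow> 'a set set \<Rightarrow> bool" where
  "cauchy_filter_base \<Lambda> d B \<longleftrightarrow> filter_base B \<and>
     (\<forall>l\<in>\<Lambda>. \<forall>e>0. \<exists>A\<in>B. \<forall>x\<in>A. \<forall>y\<in>A. d l x y < e)"

definition filter_base_converges :: "'a::topological_space set set \<Rightarrow> 'a \<Rightarrow> bool" where
  "filter_base_converges B x \<longleftrightarrow> (\<forall>U. open U \<longrightarrow> x \<in> U \<longrightarrow> (\<exists>A\<in>B. A \<subseteq> U))"

lemma cauchy_filter_generated_iff:
  fixes d :: "'i \<Rightarrow> 'a::uniform_space \<Rightarrow> 'a \<Rightarrow> real" and F :: "'a filter"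
  assumes "uniformity_generated_by \<Lambda> d"
  shows "cauchy_filter F \<longleftrightarrow>
    (\<forall>l\<in>\<Lambda>. \<forall>e>0. \<exists>P. eventually P F \<and> (\<forall>x y. P x \<longrightarrow> P y \<longrightarrow> d l x y < e))"
  unfolding cauchy_filter_def assms[unfolded uniformity_generated_by_def]
  by (simp add: le_INF_iff le_principal eventually_prod_same Ball_def)

(* The library's completeness agrees with convergence of all Cauchy filter bases. *)
lemma complete_UNIV_iff_filter_bases:
  fixes d :: "'i \<Rightarrow> 'a::uniform_space \<Rightarrow> 'a \<Rightarrow> real"
  assumes gen: "uniformity_generated_by \<Lambda> d"
  shows "complete (UNIV :: 'a set) \<longleftrightarrow>
    (\<forall>B. cauchy_filter_base \<Lambda> d B \<longrightarrow> (\<exists>x. filter_base_converges B x))"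
proof
  assume compl: "complete (UNIV :: 'a set)"
  show "\<forall>B. cauchy_filter_base \<Lambda> d B \<longrightarrow> (\<exists>x. filter_base_converges B x)"
  proof (intro allI impI)
    fix B assume B: "cauchy_filter_base \<Lambda> d B"
    define F where "F = (INF A\<in>B. principal A)"
    have ev: "eventually P F \<longleftrightarrow> (\<exists>A\<in>B. \<forall>x\<in>A. P x)" for P
      unfolding F_def
      using B by (subst eventually_INF_base)
        (auto simp: cauchy_filter_base_def filter_base_def eventually_principal)
    have "F \<noteq> bot"
      using B unfolding trivial_limit_def ev cauchy_filter_base_def filter_base_def by auto
    moreover have "cauchy_filter F"
      unfolding cauchy_filter_generated_iff[OF gen]
    proof (intro ballI allI impI)
      fix l and e :: real assume "l \<in> \<Lambda>" "0 < e"
      then obtain A where "A \<in> B" "\<forall>x\<in>A. \<forall>y\<in>A. d l x y < e"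
        using B unfolding cauchy_filter_base_def by blast
      then show "\<exists>P. eventually P F \<and> (\<forall>x y. P x \<longrightarrow> P y \<longrightarrow> d l x y < e)"
        by (intro exI[of _ "\<lambda>x. x \<in> A"]) (auto simp: ev)
    qed
    ultimately obtain x where "F \<le> nhds x"
      using compl by (auto simp: complete_uniform)
    then have "filter_base_converges B x"
      unfolding filter_base_converges_def
    proof (intro allI impI)
      fix U :: "'a set" assume "open U" "x \<in> U"
      then have "eventually (\<lambda>y. y \<in> U) F"
        using filter_leD[OF \<open>F \<le> nhds x\<close>] eventually_nhds_in_open by metis
      then show "\<exists>A\<in>B. A \<subseteq> U" by (auto simp: ev)
    qed
    then show "\<exists>x. filter_base_converges B x" ..
  qed
next
  assume conv: "\<forall>B. cauchy_filter_base \<Lambda> d B \<longrightarrow> (\<exists>x. filter_base_converges B x)"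
  show "complete (UNIV :: 'a set)"
    unfolding complete_uniform
  proof (intro allI impI)
    fix F :: "'a filter" assume F: "F \<noteq> bot" "cauchy_filter F"
    define B where "B = {A. eventually (\<lambda>x. x \<in> A) F}"
    have "filter_base B"
      unfolding filter_base_def
    proof (intro conjI ballI)
      show "B \<noteq> {}"
        unfolding B_def using always_eventually[of "\<lambda>x. x \<in> UNIV" F] by blast
      show "{} \<notin> B"
        using F(1) by (simp add: B_def trivial_limit_def)
      fix A A' assume "A \<in> B" "A' \<in> B"
      then show "\<exists>C\<in>B. C \<subseteq> A \<inter> A'"
        by (intro bexI[of _ "A \<inter> A'"]) (auto simp: B_def eventually_conj_iff)
    qed
    moreover have "\<exists>A\<in>B. \<forall>x\<in>A. \<forall>y\<in>A. d l x y < e" if le: "l \<in> \<Lambda>" "0 < e" for l and e :: real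
    proof -
      obtain P where "eventually P F" "\<forall>x y. P x \<longrightarrow> P y \<longrightarrow> d l x y < e"
        using F(2)[unfolded cauchy_filter_generated_iff[OF gen]] le by blast
      then show ?thesis
        by (intro bexI[of _ "Collect P"]) (auto simp: B_def)
    qed
    ultimately have "cauchy_filter_base \<Lambda> d B"
      unfolding cauchy_filter_base_def by blast
    with conv obtain x where x: "filter_base_converges B x"
      by blast
    have "F \<le> nhds x"
      unfolding le_filter_def
    proof (intro allI impI)
      fix P assume "eventually P (nhds x)"
      then obtain U where U: "open U" "x \<in> U" "\<forall>y\<in>U. P y"
        unfolding eventually_nhds by blast
      with x obtain A where A: "A \<in> B" "A \<subseteq> U"
        unfolding filter_base_converges_def by blast
      have "eventually (\<lambda>y. y \<in> A) F"
        using A(1) by (simp add: B_def)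
      then show "eventually P F"
        by (rule eventually_mono) (use A(2) U(3) in blast)
    qed
    then show "\<exists>x\<in>UNIV. F \<le> nhds x" by blast
  qed
qed

(* A uniform_space need not be Hausdorff. A conclusion T x = {x} for a closed-valued T fails
   without separation: on two points with the zero pseudometric, the only nonempty closed
   set is the whole space. A fixed point x \<in> T x needs no separation. *)

end

theory Submission
  imports Defs
begin

text \<open>Preorder \<open>X\<close> by \<open>x \<preceq> y\<close> iff \<open>d\<^sub>\<lambda> x y \<le> \<phi>\<^sub>\<lambda> x - \<phi>\<^sub>\<lambda> y\<close> for all \<open>\<lambda>\<close>. Along a chain each \<open>\<phi>\<^sub>\<lambda>\<close> decreases and
  is bounded below, so the tails of the chain form a Cauchy filter; by semi-continuity its limit is
  an upper bound. A maximal chain therefore yields an element \<open>m\<close> with \<open>m \<preceq> y \<Longrightarrow> y \<preceq> m\<close>, and \<open>m \<preceq> y\<close>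
  then forces \<open>d\<^sub>\<lambda> m y = 0\<close> for all \<open>\<lambda>\<close>: a point \<open>y\<close> of \<open>T m\<close> above \<open>m\<close> is indistinguishable from \<open>m\<close>.\<close>

text \<open>Zorn's lemma for preorders, with maximality up to equivalence. An upper bound
  \<open>m\<close> of a maximal chain works: anything above \<open>m\<close> lies above the whole
  chain, hence belongs to it, hence lies below \<open>m\<close>.\<close>

lemma ex_maximal_of_preorder:
  assumes refl: "\<And>x. R x x"
    and trans: "\<And>x y z. R x y \<Longrightarrow> R y z \<Longrightarrow> R x z"
    and bound: "\<And>C. (\<And>x y. x \<in> C \<Longrightarrow> y \<in> C \<Longrightarrow> R x y \<or> R y x) \<Longrightarrow> C \<noteq> {} \<Longrightarrow> \<exists>z. \<forall>x\<in>C. R x z"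
  shows "\<exists>m. \<forall>y. R m y \<longrightarrow> R y m"
proof -
  interpret pred_on UNIV R .
  obtain C where C: "maxchain C"
    using Hausdorff by blast
  \<comment> \<open>Chains in \<open>pred_on\<close> compare by the reflexive closure of
    \<open>R\<close>; reflexivity reduces this to \<open>R\<close> itself.\<close>
  have total: "R x y \<or> R y x" if "x \<in> C" "y \<in> C" for x y
    using C that refl unfolding maxchain_def chain_def by auto
  have extend: "y \<in> C" if "\<And>x. x \<in> C \<Longrightarrow> R x y" for y
  proof (rule ccontr)
    assume "y \<notin> C"
    moreover have "chain (insert y C)"
      using that total unfolding chain_def by auto
    ultimately show False
      using C unfolding maxchain_def by blast
  qed
  \<comment> \<open>For an empty \<open>C\<close> the hypothesis of \<open>extend\<close> is
    vacuous, so every point would lie in \<open>C\<close>.\<close>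
  have "C \<noteq> {}"
    using extend by blast
  then have "\<exists>m. \<forall>x\<in>C. R x m"
    by (intro bound total)
  then obtain m where m: "\<And>x. x \<in> C \<Longrightarrow> R x m"
    by blast
  have "R y m" if "R m y" for y
    by (rule m, rule extend, rule trans[OF m that])
  then show ?thesis by blast
qed

lemma eventually_uniformity_generated:
  assumes "uniformity_generated_by \<Lambda> d" "l \<in> \<Lambda>" "0 < e"
  shows "eventually (\<lambda>(x, y). d l x y < e) uniformity"
proof -
  have "uniformity \<le> principal {(x, y). d l x y < e}"
    unfolding assms(1)[unfolded uniformity_generated_by_def]
    using assms(2,3) by (intro INF_lower2[of l] INF_lower2[of e]) auto
  then show ?thesis
    by (simp add: le_principal case_prod_unfold)
qed

text \<open>The pair \<open>(x, y)\<close> lies in every subbasic set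
  \<open>{(x, y). d l x y < e}\<close>, hence in every entourage, in particular in one witnessing
  that \<open>U\<close> is a neighbourhood of \<open>x\<close>.\<close>

lemma open_indistinguishable:
  assumes gen: "uniformity_generated_by \<Lambda> d"
    and zero: "\<And>l. l \<in> \<Lambda> \<Longrightarrow> d l x y = 0"
    and "open U" "x \<in> U"
  shows "y \<in> U"
proof -
  have "principal {(x, y)} \<le> uniformity"
    unfolding gen[unfolded uniformity_generated_by_def]
    by (intro INF_greatest) (simp add: zero)
  moreover have "eventually (\<lambda>(x', w). x' = x \<longrightarrow> w \<in> U) uniformity"
    using \<open>open U\<close> \<open>x \<in> U\<close> by (simp add: open_uniformity)
  ultimately have "eventually (\<lambda>(x', w). x' = x \<longrightarrow> w \<in> U) (principal {(x, y)})"
    by (rule filter_leD)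
  then show ?thesis
    by (simp add: eventually_principal)
qed

text \<open>Passage to the limit in the order relation. A point \<open>y\<close> near
  \<open>z\<close> costs less than \<open>e / 2\<close> in the triangle inequality and less than
  \<open>e / 2\<close> in the lower bound for \<open>f y\<close>.\<close>

lemma lower_semicontinuous_decrease_limit:
  assumes pm: "pseudometric (d l)"
    and gen: "uniformity_generated_by \<Lambda> d" and l: "l \<in> \<Lambda>"
    and lsc: "lower_semicontinuous f"
    and F: "F \<noteq> bot" "F \<le> nhds z"
    and ev: "eventually (\<lambda>y. d l x y \<le> f x - f y) F"
  shows "d l x z \<le> f x - f z"
proof (rule field_le_epsilon)
  fix e :: real assume "0 < e"
  have "eventually (\<lambda>y. d l z y < e / 2) (nhds z)"
    using eventually_uniformity_generated[OF gen l, of "e / 2"] \<open>0 < e\<close>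
    unfolding eventually_nhds_uniformity by (auto elim: eventually_mono)
  moreover have "eventually (\<lambda>y. f z - e / 2 < f y) (nhds z)"
    using lsc \<open>0 < e\<close> unfolding lower_semicontinuous_def by simp
  ultimately have "eventually (\<lambda>y. d l z y < e / 2 \<and> f z - e / 2 < f y \<and> d l x y \<le> f x - f y) F"
    using filter_leD[OF F(2)] ev by (simp add: eventually_conj)
  then obtain y where y: "d l z y < e / 2" "f z - e / 2 < f y" "d l x y \<le> f x - f y"
    using eventually_happens'[OF F(1)] by blast
  have "d l x z \<le> d l x y + d l y z" "d l y z = d l z y"
    using pm unfolding pseudometric_def by blast+
  then show "d l x z \<le> f x - f z + e"
    using y by linarith
qed

definition caristi_le ::
    "'i set \<Rightarrow> ('i \<Rightarrow> 'a \<Rightarrow> 'a \<Rightarrow> real) \<Rightarrow> ('i \<Rightarrow> 'a \<Rightarrow> real) \<Rightarrow> 'a \<Rightarrow> 'a \<Rightarrow> bool" where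
  "caristi_le \<Lambda> d \<phi> x y \<longleftrightarrow> (\<forall>l\<in>\<Lambda>. d l x y \<le> \<phi> l x - \<phi> l y)"

lemma caristi_le_refl:
  assumes "\<And>l. l \<in> \<Lambda> \<Longrightarrow> pseudometric (d l)"
  shows "caristi_le \<Lambda> d \<phi> x x"
  using assms unfolding caristi_le_def pseudometric_def by auto

lemma caristi_le_trans:
  assumes pm: "\<And>l. l \<in> \<Lambda> \<Longrightarrow> pseudometric (d l)"
    and "caristi_le \<Lambda> d \<phi> x y" "caristi_le \<Lambda> d \<phi> y z"
  shows "caristi_le \<Lambda> d \<phi> x z"
  unfolding caristi_le_def
proof
  fix l assume l: "l \<in> \<Lambda>"
  then have "d l x z \<le> d l x y + d l y z"
    using pm unfolding pseudometric_def by blast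
  moreover have "d l x y \<le> \<phi> l x - \<phi> l y" "d l y z \<le> \<phi> l y - \<phi> l z"
    using assms(2,3) l unfolding caristi_le_def by blast+
  ultimately show "d l x z \<le> \<phi> l x - \<phi> l z"
    by linarith
qed

lemma caristi_chain_upper_bound:
  fixes d :: "'i \<Rightarrow> 'a::uniform_space \<Rightarrow> 'a \<Rightarrow> real"
  assumes pm: "\<And>l. l \<in> \<Lambda> \<Longrightarrow> pseudometric (d l)"
    and gen: "uniformity_generated_by \<Lambda> d"
    and compl: "complete (UNIV :: 'a set)"
    and lsc: "\<And>l. l \<in> \<Lambda> \<Longrightarrow> lower_semicontinuous (\<phi> l)"
    and bdd: "\<And>l. l \<in> \<Lambda> \<Longrightarrow> bdd_below (range (\<phi> l))"
    and chain: "\<And>x y. x \<in> C \<Longrightarrow> y \<in> C \<Longrightarrow> caristi_le \<Lambda> d \<phi> x y \<or> caristi_le \<Lambda> d \<phi> y x"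
    and ne: "C \<noteq> {}"
  shows "\<exists>z. \<forall>x\<in>C. caristi_le \<Lambda> d \<phi> x z"
proof -
  let ?R = "caristi_le \<Lambda> d \<phi>"
  note refl = caristi_le_refl[of \<Lambda> d \<phi>, OF pm]
  note trans = caristi_le_trans[of \<Lambda> d \<phi>, OF pm]
  \<comment> \<open>The filter of tails of the chain, which treats the chain as a net indexed by
    itself.\<close>
  define F where "F = (INF x\<in>C. principal {y \<in> C. ?R x y})"
  \<comment> \<open>Of two tails, the one starting at the larger point is contained in the other, by
    transitivity.\<close>
  have directed: "\<exists>w\<in>C. {v \<in> C. ?R w v} \<subseteq> {v \<in> C. ?R x v} \<inter> {v \<in> C. ?R y v}"
    if xy: "x \<in> C" "y \<in> C" for x y
    using chain[OF xy]
  proof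
    assume "?R x y"
    then show ?thesis using xy trans by (intro bexI[of _ y]) auto
  next
    assume "?R y x"
    then show ?thesis using xy trans by (intro bexI[of _ x]) auto
  qed
  have ev: "eventually P F \<longleftrightarrow> (\<exists>x\<in>C. \<forall>y\<in>C. ?R x y \<longrightarrow> P y)" for P
  proof -
    have "eventually P F \<longleftrightarrow> (\<exists>x\<in>C. eventually P (principal {y \<in> C. ?R x y}))"
      unfolding F_def
    proof (rule eventually_INF_base[OF ne])
      fix x y assume "x \<in> C" "y \<in> C"
      then show "\<exists>w\<in>C. principal {v \<in> C. ?R w v}
          \<le> inf (principal {v \<in> C. ?R x v}) (principal {v \<in> C. ?R y v})"
        using directed by (simp only: inf_principal principal_le_iff)
    qed
    then show ?thesis by (auto simp: eventually_principal)
  qed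
  \<comment> \<open>Every tail contains its own starting point.\<close>
  have "\<not> eventually (\<lambda>_. False) F"
    unfolding ev using refl by blast
  then have "F \<noteq> bot"
    by (simp add: trivial_limit_def)
  moreover have "cauchy_filter F"
    unfolding cauchy_filter_generated_iff[OF gen]
  proof (intro ballI allI impI)
    fix l and e :: real assume l: "l \<in> \<Lambda>" and "0 < e"
    have bddC: "bdd_below (\<phi> l ` C)"
      using bdd[OF l] by (rule bdd_below_mono) auto
    \<comment> \<open>Beyond such an \<open>x\<close>, all values of \<open>\<phi> l\<close> on the
      chain lie between the infimum and \<open>\<phi> l x\<close>, an interval of length less than
      \<open>e\<close>.\<close>
    obtain x where x: "x \<in> C" "\<phi> l x < Inf (\<phi> l ` C) + e"
      using cInf_lessD[of "\<phi> l ` C" "Inf (\<phi> l ` C) + e"] ne \<open>0 < e\<close> by auto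
    have close: "d l y w < e" if "w \<in> C" "?R x y" "?R y w" for y w
    proof -
      have "0 \<le> d l x y"
        using pm[OF l] unfolding pseudometric_def by blast
      moreover have "d l x y \<le> \<phi> l x - \<phi> l y" "d l y w \<le> \<phi> l y - \<phi> l w"
        using that(2,3) l unfolding caristi_le_def by blast+
      moreover have "Inf (\<phi> l ` C) \<le> \<phi> l w"
        using bddC that(1) by (rule cINF_lower)
      ultimately show ?thesis using x(2) by linarith
    qed
    \<comment> \<open>Any two points of the tail are comparable, so symmetry of \<open>d l\<close>
      reduces to the ordered case \<open>close\<close>.\<close>
    have "d l y w < e" if yw: "y \<in> C" "w \<in> C" "?R x y" "?R x w" for y w
      using chain[OF yw(1,2)]
    proof
      assume "?R y w"
      then show ?thesis by (rule close[OF yw(2,3)])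
    next
      assume "?R w y"
      then have "d l w y < e" by (rule close[OF yw(1,4)])
      moreover have "d l y w = d l w y"
        using pm[OF l] unfolding pseudometric_def by blast
      ultimately show ?thesis by simp
    qed
    moreover have "eventually (\<lambda>y. y \<in> C \<and> ?R x y) F"
      unfolding ev using x(1) by blast
    ultimately show "\<exists>P. eventually P F \<and> (\<forall>y w. P y \<longrightarrow> P w \<longrightarrow> d l y w < e)"
      by blast
  qed
  ultimately obtain z where z: "F \<le> nhds z"
    using compl by (auto simp: complete_uniform)
  have "?R x z" if "x \<in> C" for x
    unfolding caristi_le_def
  proof
    fix l assume l: "l \<in> \<Lambda>"
    \<comment> \<open>The inequality holds on the tail starting at \<open>x\<close>, so it survives
      at the limit.\<close>
    have "eventually (\<lambda>y. d l x y \<le> \<phi> l x - \<phi> l y) F"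
      using that l unfolding ev caristi_le_def by blast
    then show "d l x z \<le> \<phi> l x - \<phi> l z"
      by (rule lower_semicontinuous_decrease_limit[OF pm[OF l] gen l lsc[OF l] \<open>F \<noteq> bot\<close> z])
  qed
  then show ?thesis by blast
qed

lemma caristi_maximal:
  fixes d :: "'i \<Rightarrow> 'a::uniform_space \<Rightarrow> 'a \<Rightarrow> real"
  assumes pm: "\<And>l. l \<in> \<Lambda> \<Longrightarrow> pseudometric (d l)"
    and gen: "uniformity_generated_by \<Lambda> d"
    and compl: "complete (UNIV :: 'a set)"
    and lsc: "\<And>l. l \<in> \<Lambda> \<Longrightarrow> lower_semicontinuous (\<phi> l)"
    and bdd: "\<And>l. l \<in> \<Lambda> \<Longrightarrow> bdd_below (range (\<phi> l))"
  shows "\<exists>m. \<forall>y. caristi_le \<Lambda> d \<phi> m y \<longrightarrow> (\<forall>l\<in>\<Lambda>. d l m y = 0)"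
proof -
  have "\<exists>m. \<forall>y. caristi_le \<Lambda> d \<phi> m y \<longrightarrow> caristi_le \<Lambda> d \<phi> y m"
  proof (rule ex_maximal_of_preorder)
    show "caristi_le \<Lambda> d \<phi> x x" for x
      by (rule caristi_le_refl[OF pm])
    show "caristi_le \<Lambda> d \<phi> x z" if "caristi_le \<Lambda> d \<phi> x y" "caristi_le \<Lambda> d \<phi> y z" for x y z
      by (rule caristi_le_trans[OF pm that])
    show "\<exists>z. \<forall>x\<in>C. caristi_le \<Lambda> d \<phi> x z"
      if "\<And>x y. x \<in> C \<Longrightarrow> y \<in> C \<Longrightarrow> caristi_le \<Lambda> d \<phi> x y \<or> caristi_le \<Lambda> d \<phi> y x" "C \<noteq> {}" for C
      by (rule caristi_chain_upper_bound[OF pm gen compl lsc bdd that])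
  qed
  then obtain m where m: "\<And>y. caristi_le \<Lambda> d \<phi> m y \<Longrightarrow> caristi_le \<Lambda> d \<phi> y m" by blast
  have "d l m y = 0" if y: "caristi_le \<Lambda> d \<phi> m y" and l: "l \<in> \<Lambda>" for y l
  proof -
    \<comment> \<open>The two inequalities add up to
      \<open>d l m y + d l y m \<le> 0\<close>.\<close>
    have "d l m y \<le> \<phi> l m - \<phi> l y" "d l y m \<le> \<phi> l y - \<phi> l m"
      using y m[OF y] l unfolding caristi_le_def by auto
    moreover have "0 \<le> d l m y" "d l y m = d l m y"
      using pm[OF l] unfolding pseudometric_def by blast+
    ultimately show ?thesis by linarith
  qed
  then show ?thesis by blast
qed

theorem theorem12:
  fixes \<Lambda> :: "'i set"
    and d :: "'i \<Rightarrow> 'a::uniform_space \<Rightarrow> 'a \<Rightarrow> real"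
    and T :: "'a \<Rightarrow> 'a set"
    and \<phi> :: "'i \<Rightarrow> 'a \<Rightarrow> real"
  assumes "\<And>l. l \<in> \<Lambda> \<Longrightarrow> pseudometric (d l)"
    and "saturated_family \<Lambda> d"
    and "uniformity_generated_by \<Lambda> d"
    and "complete (UNIV :: 'a set)"
    and "\<And>x. closed (T x) \<and> T x \<noteq> {}"
    and "\<And>l. l \<in> \<Lambda> \<Longrightarrow> lower_semicontinuous (\<phi> l)"
    and "\<And>l. l \<in> \<Lambda> \<Longrightarrow> bdd_below (range (\<phi> l))"
  shows "((\<forall>x. \<exists>y\<in>T x. \<forall>l\<in>\<Lambda>. d l x y \<le> \<phi> l x - \<phi> l y) \<longrightarrow> (\<exists>x. x \<in> T x)) \<and>
    (Hausdorff_space (euclidean :: 'a topology) \<longrightarrow>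
      (\<forall>x. \<forall>y\<in>T x. \<forall>l\<in>\<Lambda>. d l x y \<le> \<phi> l x - \<phi> l y) \<longrightarrow> (\<exists>x. {x} = T x))"
proof -
  \<comment> \<open>The point \<open>m\<close> depends on \<open>d\<close> and \<open>\<phi>\<close>
    but not on \<open>T\<close>, so it serves both propositions.\<close>
  obtain m where m: "\<And>y l. \<forall>l\<in>\<Lambda>. d l m y \<le> \<phi> l m - \<phi> l y \<Longrightarrow> l \<in> \<Lambda> \<Longrightarrow> d l m y = 0"
    using caristi_maximal[of \<Lambda> d \<phi>, OF assms(1,3,4,6,7)] unfolding caristi_le_def by blast
  show ?thesis
  proof (intro conjI impI)
    assume "\<forall>x. \<exists>y\<in>T x. \<forall>l\<in>\<Lambda>. d l x y \<le> \<phi> l x - \<phi> l y"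
    then obtain y where y: "y \<in> T m" "\<forall>l\<in>\<Lambda>. d l m y \<le> \<phi> l m - \<phi> l y"
      by blast
    \<comment> \<open>Otherwise the open complement of \<open>T m\<close> contains \<open>m\<close>,
      and with it the indistinguishable point \<open>y\<close> of \<open>T m\<close>.\<close>
    have "m \<in> T m"
    proof (rule ccontr)
      assume "m \<notin> T m"
      then have "y \<in> - T m"
        using open_indistinguishable[OF assms(3) m[OF y(2)], of "- T m"] assms(5)
        by (simp add: open_Compl)
      then show False using y(1) by simp
    qed
    then show "\<exists>x. x \<in> T x" ..
  next
    assume H: "Hausdorff_space (euclidean :: 'a topology)"
      and le: "\<forall>x. \<forall>y\<in>T x. \<forall>l\<in>\<Lambda>. d l x y \<le> \<phi> l x - \<phi> l y"
    \<comment> \<open>Here every point of \<open>T m\<close> is above \<open>m\<close>, hence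
      indistinguishable from it; separation makes them equal, and \<open>T m\<close> is
      nonempty.\<close>
    have "y = m" if "y \<in> T m" for y
    proof (rule ccontr)
      assume "y \<noteq> m"
      then obtain U V where UV: "open U" "open V" "m \<in> U" "y \<in> V" "U \<inter> V = {}"
        using H[unfolded Hausdorff_space_def, rule_format, of m y] by (auto simp: disjnt_def)
      have zero: "\<And>l. l \<in> \<Lambda> \<Longrightarrow> d l m y = 0"
        using m le that by blast
      have "y \<in> U"
        by (rule open_indistinguishable[OF assms(3) zero UV(1,3)])
      then show False using UV by blast
    qed
    then show "\<exists>x. {x} = T x"
      using assms(5)[of m] by blast
  qed
qed

end
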